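(* For every positive integer $n$, the group $G_n=\{\sigma_{\tau,n}:\gcd(\tau,n)=1\}$ (under composition of permutations) is isomorphic to the group $U_n=\{k:\gcd(k,n)=1\}$ of units modulo $n$, with group operation multiplication mod $n$.
   Context: For an integer $a$, $a \text{ Mod } n$ denotes the unique $b\in\{1,\dots,n\}$ with $b\equiv a\pmod n$. For an integer $\tau$ with $\gcd(\tau,n)=1$, $\sigma_{\tau,n}$ is the permutation of $\{1,\dots,n\}$ given by $\sigma_{\tau,n}(i)=(i-1)\tau+1 \text{ Mod } n$. Elements of $U_n$ are residue classes mod $n$. *)

theory Defs
  imports
    "HOL-Number_Theory.Cong"
    "HOL-Algebra.IntRing"
    "HOL-Algebra.Sym_Groups"
begin

definition pos_mod :: "int \<Rightarrow> nat \<Rightarrow> nat"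
  where "pos_mod a n = (THE b. b \<in> {1..n} \<and> [int b = a] (mod int n))"

lemma pos_mod_ex1:
  assumes "n > 0"
  shows "\<exists>!b. b \<in> {1..n} \<and> [int b = a] (mod int n)"
proof (rule ex1I)
  let ?b = "nat ((a - 1) mod int n) + 1"
  have nn: "(a - 1) mod int n \<ge> 0" and lt: "(a - 1) mod int n < int n"
    using assms by simp_all
  have "int ?b = (a - 1) mod int n + 1" using nn by simp
  moreover have "[(a - 1) mod int n + 1 = a] (mod int n)"
    by (simp add: cong_def mod_simps)
  ultimately show "?b \<in> {1..n} \<and> [int ?b = a] (mod int n)"
    using nn lt by (auto simp: add.commute)
next
  let ?b = "nat ((a - 1) mod int n) + 1"
  fix b assume b: "b \<in> {1..n} \<and> [int b = a] (mod int n)"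
  hence "[int b - 1 = a - 1] (mod int n)" by (intro cong_diff) auto
  hence "(int b - 1) mod int n = (a - 1) mod int n" by (simp add: cong_def)
  moreover have "(int b - 1) mod int n = int b - 1" using b by (intro mod_pos_pos_trivial) auto
  ultimately show "b = ?b" using b by auto
qed

text \<open>Library permutations of \<open>{1..n}\<close> are functions on all of \<open>nat\<close> that fix every point
  outside \<open>{1..n}\<close>.\<close>

definition sigma :: "int \<Rightarrow> nat \<Rightarrow> nat \<Rightarrow> nat"
  where "sigma \<tau> n i = (if i \<in> {1..n} then pos_mod ((int i - 1) * \<tau> + 1) n else i)"

definition sigma_set :: "nat \<Rightarrow> (nat \<Rightarrow> nat) set"
  where "sigma_set n = {sigma \<tau> n | \<tau>. coprime \<tau> (int n)}"

definition sigma_group :: "nat \<Rightarrow> (nat \<Rightarrow> nat) monoid"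
  where "sigma_group n = (sym_group n)\<lparr>carrier := sigma_set n\<rparr>"

text \<open>\<open>ZMod (int n) k\<close> is the residue class of \<open>k\<close>, an element of the quotient ring
  \<open>ZFact (int n)\<close> of the integers, whose multiplication is used here.\<close>

definition unit_classes :: "nat \<Rightarrow> int set monoid"
  where "unit_classes n =
    \<lparr>carrier = {ZMod (int n) k | k. coprime k (int n)},
     mult = mult (ZFact (int n)),
     one = one (ZFact (int n))\<rparr>"

lemma unit_classes_mult:
  "ZMod (int n) a \<otimes>\<^bsub>unit_classes n\<^esub> ZMod (int n) b = ZMod (int n) (a * b)"
proof -
  interpret ideal "Idl\<^bsub>\<Z>\<^esub> {int n}" \<Z> by (rule int.genideal_ideal) simp
  show ?thesis
    unfolding unit_classes_def ZMod_def ZFact_defs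
    using rcoset_mult_add[of a b] by simp
qed

end

(* Composing i |-> (i - 1) a + 1 with i |-> (i - 1) b + 1 modulo n multiplies the
   factors, so tau |-> sigma_tau is multiplicative; and tau modulo n is recovered from
   sigma_tau as sigma_tau(2) - 1. *)
theory Submission
  imports Defs
begin

lemma pos_mod:
  assumes "n > 0"
  shows pos_mod_range: "pos_mod a n \<in> {1..n}"
    and cong_pos_mod: "[int (pos_mod a n) = a] (mod int n)"
  using theI'[OF pos_mod_ex1[OF assms, of a]] unfolding pos_mod_def by auto

lemma pos_mod_eqI:
  assumes "b \<in> {1..n}" "[int b = a] (mod int n)"
  shows "pos_mod a n = b"
proof -
  have "n > 0" using assms(1) by auto
  from pos_mod_ex1[OF this, of a] show ?thesis
    unfolding pos_mod_def using assms by (intro the1_equality) auto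
qed

lemma pos_mod_cong:
  assumes "n > 0" "[a = b] (mod int n)"
  shows "pos_mod a n = pos_mod b n"
  using assms by (intro pos_mod_eqI pos_mod_range) (auto intro: cong_pos_mod cong_trans cong_sym)

text \<open>The multiplier matters only through its residue class. This gives inverses below and
  later the injectivity of the isomorphism.\<close>

lemma sigma_cong: "[a = b] (mod int n) \<Longrightarrow> sigma a n = sigma b n"
  unfolding sigma_def by (auto simp: fun_eq_iff intro!: pos_mod_cong cong_add cong_mult)

lemma sigma_1: "sigma 1 n = id"
  unfolding sigma_def by (auto simp: fun_eq_iff intro!: pos_mod_eqI)

lemma sigma_comp: "sigma a n \<circ> sigma b n = sigma (a * b) n"
proof
  fix i
  show "(sigma a n \<circ> sigma b n) i = sigma (a * b) n i"
  proof (cases "i \<in> {1..n}")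
    case True
    then have n: "n > 0" by auto
    let ?j = "pos_mod ((int i - 1) * b + 1) n"
    \<comment> \<open>\<open>?j\<close> is replaced by the integer it reduces; the inner
      \<open>+ 1\<close> then cancels against the shift \<open>- 1\<close>, leaving the product of
      the factors.\<close>
    have "[(int ?j - 1) * a + 1 = ((int i - 1) * b + 1 - 1) * a + 1] (mod int n)"
      by (intro cong_add cong_mult cong_diff cong_pos_mod n cong_refl)
    then have "pos_mod ((int ?j - 1) * a + 1) n = pos_mod ((int i - 1) * (a * b) + 1) n"
      by (intro pos_mod_cong n) (simp add: algebra_simps)
    then show ?thesis
      using True pos_mod_range[OF n] by (simp add: sigma_def)
  qed (auto simp: sigma_def)
qed

lemma sigma_inverse:
  assumes "[a * b = 1] (mod int n)"
  shows "sigma a n \<circ> sigma b n = id"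
  using sigma_cong[OF assms] by (simp add: sigma_comp sigma_1)

text \<open>Bezout inverse modulo \<open>m\<close>. Its own coprimality keeps it an admissible
  multiplier, and both orders are provided because later steps need left or two-sided
  inverses.\<close>

lemma coprime_int_inverse:
  fixes a m :: int
  assumes "coprime a m"
  obtains b where "coprime b m" "[a * b = 1] (mod m)" "[b * a = 1] (mod m)"
  using assms by (metis cong_solve_coprime_int coprime_iff_invertible_int mult.commute)

lemma sigma_permutes:
  assumes "coprime a (int n)"
  shows "sigma a n permutes {1..n}"
proof -
  obtain b where "[a * b = 1] (mod int n)" "[b * a = 1] (mod int n)"
    using coprime_int_inverse[OF assms] .
  \<comment> \<open>A two-sided inverse under composition is \<open>sigma b n\<close>, which gives
    bijectivity on all of \<open>nat\<close>; points outside \<open>{1..n}\<close> are fixed by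
    definition.\<close>
  then have "bij (sigma a n)"
    using o_bij sigma_inverse by blast
  then show ?thesis
    by (auto simp: permutes_bij bij_iff sigma_def permutes_def)
qed

(* For n = 1 the point 2 is outside {1..n} and fixed, but all integers are congruent. *)
lemma sigma_2_cong:
  assumes "n > 0"
  shows "[int (sigma a n 2) - 1 = a] (mod int n)"
proof (cases "n = 1")
  case False
  with assms have "sigma a n 2 = pos_mod (a + 1) n" by (simp add: sigma_def)
  with cong_diff[OF cong_pos_mod[OF assms, of "a + 1"] cong_refl, of 1] show ?thesis by simp
qed simp

text \<open>Recovers the class of the multiplier from the permutation alone, so the isomorphism can
  be defined without choosing a representative.\<close>

lemma ZMod_sigma_2: "n > 0 \<Longrightarrow> ZMod (int n) (int (sigma a n 2) - 1) = ZMod (int n) a"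
  using sigma_2_cong by (auto simp: ZMod_eq_mod cong_def)

text \<open>This makes \<open>sigma_group n\<close> a group, which \<open>\<cong>\<close> between
  records does not assert by itself.\<close>

lemma subgroup_sigma_set: "subgroup (sigma_set n) (sym_group n)"
proof (rule group.subgroupI[OF sym_group_is_group])
  show sub: "sigma_set n \<subseteq> carrier (sym_group n)"
    using sigma_permutes by (auto simp only: sigma_set_def sym_group_carrier)
  show "sigma_set n \<noteq> {}"
    by (auto simp: sigma_set_def intro!: exI[of _ 1])
  show "inv\<^bsub>sym_group n\<^esub> p \<in> sigma_set n" if p: "p \<in> sigma_set n" for p
  proof -
    from p obtain a where a: "p = sigma a n" "coprime a (int n)"
      by (auto simp: sigma_set_def)
    obtain b where b: "coprime b (int n)" "[b * a = 1] (mod int n)"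
      using coprime_int_inverse[OF a(2)] .
    have b_mem: "sigma b n \<in> sigma_set n" using b by (auto simp: sigma_set_def)
    \<comment> \<open>In a group a left inverse is the inverse, so \<open>b * a\<close> congruent to
      1 suffices.\<close>
    have "inv\<^bsub>sym_group n\<^esub> p = sigma b n"
      using p b_mem sub sigma_inverse[OF b(2)]
      by (intro group.inv_equality[OF sym_group_is_group])
        (auto simp: a sym_group_mult sym_group_one)
    with b_mem show ?thesis by simp
  qed
  show "p \<otimes>\<^bsub>sym_group n\<^esub> q \<in> sigma_set n" if "p \<in> sigma_set n" "q \<in> sigma_set n" for p q
  proof -
    from that obtain a b where "p = sigma a n" "coprime a (int n)"
      "q = sigma b n" "coprime b (int n)"
      by (auto simp: sigma_set_def)
    then show ?thesis
      by (auto simp: sigma_set_def sym_group_mult sigma_comp intro!: exI[of _ "a * b"])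
  qed
qed

lemma unit_classes_carrier: "carrier (unit_classes n) = {ZMod (int n) k | k. coprime k (int n)}"
  by (simp add: unit_classes_def)

lemma unit_classes_one: "\<one>\<^bsub>unit_classes n\<^esub> = ZMod (int n) 1"
  by (simp add: unit_classes_def ZMod_def ZFact_defs)

lemma group_unit_classes: "group (unit_classes n)"
proof (rule groupI)
  show "\<exists>y\<in>carrier (unit_classes n). y \<otimes>\<^bsub>unit_classes n\<^esub> x = \<one>\<^bsub>unit_classes n\<^esub>"
    if x: "x \<in> carrier (unit_classes n)" for x
  proof -
    from x obtain a where a: "x = ZMod (int n) a" "coprime a (int n)"
      by (auto simp: unit_classes_carrier)
    obtain b where b: "coprime b (int n)" "[b * a = 1] (mod int n)"
      using coprime_int_inverse[OF a(2)] .
    then show ?thesis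
      \<comment> \<open>The left inverse is the class of the Bezout inverse
        \<open>b\<close>.\<close>
      by (intro bexI[of _ "ZMod (int n) b"])
        (auto simp: a unit_classes_carrier unit_classes_mult unit_classes_one ZMod_eq_mod cong_def)
  qed
next
  show "x \<otimes>\<^bsub>unit_classes n\<^esub> y \<in> carrier (unit_classes n)"
    if "x \<in> carrier (unit_classes n)" "y \<in> carrier (unit_classes n)" for x y
  proof -
    from that obtain a b where "x = ZMod (int n) a" "coprime a (int n)"
      "y = ZMod (int n) b" "coprime b (int n)"
      by (auto simp: unit_classes_carrier)
    then show ?thesis
      by (auto simp: unit_classes_carrier unit_classes_mult intro!: exI[of _ "a * b"])
  qed
qed (auto simp: unit_classes_carrier unit_classes_mult unit_classes_one mult.assoc
    intro: exI[of _ 1])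

lemma sigma_group_iso:
  assumes "n > 0"
  shows "(\<lambda>p. ZMod (int n) (int (p 2) - 1)) \<in> iso (sigma_group n) (unit_classes n)"
proof (rule isoI)
  let ?h = "\<lambda>p :: nat \<Rightarrow> nat. ZMod (int n) (int (p 2) - 1)"
  have carrier: "carrier (sigma_group n) = sigma_set n"
    and mult: "mult (sigma_group n) = (\<circ>)"
    by (simp_all add: sigma_group_def sym_group_mult)
  note h = ZMod_sigma_2[OF assms]
  show "?h \<in> hom (sigma_group n) (unit_classes n)"
  proof (rule homI)
    fix p q assume "p \<in> carrier (sigma_group n)" "q \<in> carrier (sigma_group n)"
    then obtain a b where "p = sigma a n" "q = sigma b n"
      by (auto simp: carrier sigma_set_def)
    then show "?h (p \<otimes>\<^bsub>sigma_group n\<^esub> q) = ?h p \<otimes>\<^bsub>unit_classes n\<^esub> ?h q"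
      by (simp only: mult sigma_comp h unit_classes_mult)
  qed (auto simp: carrier sigma_set_def h unit_classes_carrier)
  \<comment> \<open>Equal classes mean congruent multipliers, hence equal permutations by
    \<open>sigma_cong\<close>.\<close>
  have "inj_on ?h (sigma_set n)"
    by (auto simp: inj_on_def sigma_set_def h cong_def intro!: sigma_cong dest: ZMod_imp_zmod)
  \<comment> \<open>The class of a coprime \<open>k\<close> is the image of
    \<open>sigma k n\<close>.\<close>
  moreover have "?h ` sigma_set n = carrier (unit_classes n)"
    by (force simp: sigma_set_def h unit_classes_carrier image_iff)
  ultimately show "bij_betw ?h (carrier (sigma_group n)) (carrier (unit_classes n))"
    by (simp add: bij_betw_def carrier)
qed

theorem theorem3p7:
  fixes n :: nat
  assumes "n > 0"
  shows "subgroup (sigma_set n) (sym_group n) \<and> group (unit_classes n) \<and>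
         sigma_group n \<cong> unit_classes n"
  using subgroup_sigma_set group_unit_classes sigma_group_iso[OF assms]
  by (auto simp: is_iso_def)

end
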